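(* Let $0<r<1$ and let $A_r=\{z\in\mathbb{C} : r<|z|<1\}$. Then for every $z\in\mathbb{C}$ with $r<|z|<1$, the squeezing function $S_{A_r}$ of $A_r$ satisfies \[ S_{A_r}(z)=\max\left\{|z|,\frac{r}{|z|}\right\}. \]
   Context: For a bounded domain $\Omega\subset\mathbb{C}$ and $z\in\Omega$, let $\mathcal{F}_\Omega(z)$ be the collection of all holomorphic embeddings (injective holomorphic maps) $f:\Omega\to\mathbb{C}$ with $f(z)=0$. With $\mathbb{D}_\rho=\{w\in\mathbb{C}:|w|<\rho\}$ for $\rho>0$, the squeezing function of $\Omega$ at $z$ is \[ S_\Omega(z)=\sup_{f\in\mathcal{F}_\Omega(z)}\left\{\frac{a}{b} : \mathbb{D}_a\subset f(\Omega)\subset\mathbb{D}_b\right\}, \] where the supremum is over all $f\in\mathcal{F}_\Omega(z)$ and all $a,b>0$ satisfying the displayed inclusions. *)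

theory Defs
  imports "HOL-Complex_Analysis.Complex_Analysis"
begin

text \<open>
  Maps are total functions on \<^typ>\<open>complex\<close>; only their values on \<open>\<Omega>\<close> matter below.
\<close>

definition embeddings_at :: "complex set \<Rightarrow> complex \<Rightarrow> (complex \<Rightarrow> complex) set"
  where "embeddings_at \<Omega> z = {f. f holomorphic_on \<Omega> \<and> inj_on f \<Omega> \<and> f z = 0}"

definition squeezing_ratios :: "complex set \<Rightarrow> complex \<Rightarrow> real set"
  where "squeezing_ratios \<Omega> z =
    {a / b | f a b. f \<in> embeddings_at \<Omega> z \<and> 0 < a \<and> 0 < b \<and>
       ball 0 a \<subseteq> f ` \<Omega> \<and> f ` \<Omega> \<subseteq> ball 0 b}"

text \<open>
  The supremum is taken in \<^typ>\<open>real\<close>. It is the genuine least upper bound whenever \<open>\<Omega>\<close> is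
  bounded and open and \<open>z \<in> \<Omega>\<close>, by the two lemmas after the definition.
\<close>

definition squeezing :: "complex set \<Rightarrow> complex \<Rightarrow> real"
  where "squeezing \<Omega> z = Sup (squeezing_ratios \<Omega> z)"

lemma bdd_above_squeezing_ratios: "bdd_above (squeezing_ratios \<Omega> z)"
proof (rule bdd_aboveI)
  fix x assume "x \<in> squeezing_ratios \<Omega> z"
  then obtain f a b where x: "x = a / b" "0 < a" "0 < b"
      "ball 0 a \<subseteq> f ` \<Omega>" "f ` \<Omega> \<subseteq> ball (0::complex) b"
    unfolding squeezing_ratios_def by blast
  then have "ball (0::complex) a \<subseteq> ball 0 b" by blast
  with x have "a \<le> b" by (simp add: ball_subset_ball_iff)
  with x show "x \<le> 1" by simp
qed

lemma squeezing_ratios_nonempty: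
  assumes "open \<Omega>" "bounded \<Omega>" "z \<in> \<Omega>"
  shows "squeezing_ratios \<Omega> z \<noteq> {}"
proof -
  obtain a where a: "0 < a" "ball z a \<subseteq> \<Omega>"
    using assms openE by blast
  obtain b where b: "0 < b" "\<Omega> \<subseteq> ball z b"
    using bounded_subset_ballD[OF assms(2)] by blast
  define f where "f = (\<lambda>w. w - z)"
  have "f \<in> embeddings_at \<Omega> z"
    unfolding embeddings_at_def f_def by (auto intro!: holomorphic_intros inj_onI)
  moreover have "ball 0 a \<subseteq> f ` \<Omega>"
  proof
    fix w assume "w \<in> ball (0::complex) a"
    then have "w + z \<in> \<Omega>" using a(2) by (auto simp: dist_norm)
    then show "w \<in> f ` \<Omega>" by (auto simp: f_def intro: image_eqI[where x = "w + z"])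
  qed
  moreover have "f ` \<Omega> \<subseteq> ball 0 b"
    using b(2) by (auto simp: f_def dist_norm norm_minus_commute)
  ultimately have "a / b \<in> squeezing_ratios \<Omega> z"
    using a(1) b(1) unfolding squeezing_ratios_def by blast
  then show ?thesis by blast
qed

definition annulus :: "real \<Rightarrow> complex set"
  where "annulus r = {z. r < norm z \<and> norm z < 1}"

end

theory Submission
  imports Defs
begin

text \<open>
  Upper bound. Let \<open>f\<close> be an embedding of the annulus with \<open>f p = 0\<close> whose image contains the disc of
  radius \<open>a\<close> and lies in the disc of radius \<open>b\<close>. Its only zero is the simple zero \<open>p\<close>, so by Jensen's
  formula the mean of \<open>ln |f|\<close> over the circle of radius \<open>\<rho>\<close> is \<open>n ln \<rho> + c + ln (max \<rho> |p|)\<close>, where the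
  integer \<open>n\<close> is the winding number around 0 of the image of a circle inside \<open>|z| = |p|\<close>. Near both
  boundary circles \<open>|f|\<close> is at least nearly \<open>a\<close> and at most \<open>b\<close>. Comparing the mean at the two ends gives
  \<open>a / b \<le> |p|\<close> when \<open>n \<ge> 0\<close> and \<open>a / b \<le> r / |p|\<close> when \<open>n \<le> -1\<close>. This is
  \<open>squeezing_ratio_upper_bound\<close>.

  Lower bound. The ratio \<open>|p|\<close> is attained by the conformal map onto the unit disc minus an arc of the
  circle of radius \<open>|p|\<close> that sends \<open>p\<close> to 0 and the unit circle to itself. After a rotation
  \<open>p = s\<close> is real and positive, and the map is
  \<open>(z - s) / (1 - s z) exp (B (1 / z) - B z)\<close> for an explicit power series \<open>B\<close>, chosen so that the modulus
  is constant on the inner circle (\<open>slit_map_exponent_exists\<close>). Injectivity and the shape of the image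
  follow from the boundary values alone by the argument principle
  (\<open>embedding_by_boundary_values\<close>). The ratio \<open>r / |p|\<close> is attained by composing the extremal map for
  \<open>r / p\<close> with the automorphism \<open>z \<mapsto> r / z\<close> of the annulus, which exchanges the boundary circles.
\<close>

section \<open>The argument principle between two circles\<close>

definition open_annulus :: "real \<Rightarrow> real \<Rightarrow> complex set"
  where "open_annulus a b = {z. a < norm z \<and> norm z < b}"

lemma open_open_annulus [intro, simp]: "open (open_annulus a b)"
  unfolding open_annulus_def by (intro open_Collect_conj open_Collect_less continuous_intros)

lemma connected_open_annulus [intro, simp]: "connected (open_annulus a b)"
  using connected_annulus(1)[of a "0::complex" b] by (simp add: open_annulus_def)

lemma annulus_eq_open_annulus: "annulus r = open_annulus r 1"
  by (simp add: annulus_def open_annulus_def)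

lemma norm_circlepath_0 [simp]: "norm (circlepath 0 \<rho> t) = \<bar>\<rho>\<bar>"
  by (simp add: circlepath norm_mult)

lemma circlepath_0_eq_0_iff [simp]: "circlepath 0 \<rho> t = 0 \<longleftrightarrow> \<rho> = 0"
  using norm_circlepath_0[of \<rho> t] by (metis abs_eq_0_iff norm_eq_zero)

lemma winding_number_image:
  assumes "f holomorphic_on S" "open S" "valid_path \<gamma>" "path_image \<gamma> \<subseteq> S"
    "w \<notin> f ` path_image \<gamma>"
  shows "winding_number (f \<circ> \<gamma>) w =
    1 / (2 * pi * \<i>) * contour_integral \<gamma> (\<lambda>z. deriv f z / (f z - w))"
proof -
  have "f analytic_on S" using assms by (simp add: analytic_on_open)
  then have "contour_integral (f \<circ> \<gamma>) (\<lambda>u. 1 / (u - w)) =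
      contour_integral \<gamma> (\<lambda>z. deriv f z * (1 / (f z - w)))"
    using assms by (intro contour_integral_comp_analyticW)
  moreover have "winding_number (f \<circ> \<gamma>) w =
      1 / (2 * pi * \<i>) * contour_integral (f \<circ> \<gamma>) (\<lambda>u. 1 / (u - w))"
    using assms
    by (intro winding_number_valid_path valid_path_compose_holomorphic[of _ f S])
       (auto simp: path_image_compose)
  ultimately show ?thesis by simp
qed

lemma homotopic_loops_circlepath:
  assumes "0 \<le> a" "a < \<rho>" "\<rho> < b" "a < \<rho>'" "\<rho>' < b"
  shows "homotopic_loops (open_annulus a b) (circlepath 0 \<rho>) (circlepath 0 \<rho>')"
proof (rule homotopic_loops_linear)
  fix t :: real
  show "closed_segment (circlepath 0 \<rho> t) (circlepath 0 \<rho>' t) \<subseteq> open_annulus a b"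
  proof
    fix x assume "x \<in> closed_segment (circlepath 0 \<rho> t) (circlepath 0 \<rho>' t)"
    then obtain u where u: "0 \<le> u" "u \<le> 1"
      and x: "x = (1 - u) *\<^sub>R circlepath 0 \<rho> t + u *\<^sub>R circlepath 0 \<rho>' t"
      by (auto simp: closed_segment_def)
    have "x = of_real ((1 - u) * \<rho> + u * \<rho>') * exp (2 * of_real pi * \<i> * of_real t)"
      unfolding x circlepath by (simp add: scaleR_conv_of_real algebra_simps)
    then have "norm x = \<bar>(1 - u) * \<rho> + u * \<rho>'\<bar>"
      by (simp add: norm_mult flip: of_real_mult of_real_add of_real_diff)
    moreover have "a < (1 - u) * \<rho> + u * \<rho>'" "(1 - u) * \<rho> + u * \<rho>' < b"
      using convex_bound_lt[of "- \<rho>" "- a" "- \<rho>'" "1 - u" u]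
        convex_bound_lt[of \<rho> b \<rho>' "1 - u" u] assms u
      by auto
    ultimately show "x \<in> open_annulus a b"
      using assms by (simp add: open_annulus_def)
  qed
qed (simp_all add: valid_path_imp_path)

lemma winding_number_image_circle_eq:
  assumes "continuous_on (open_annulus a b) f" "\<And>z. z \<in> open_annulus a b \<Longrightarrow> f z \<noteq> w"
    and "0 \<le> a" "a < \<rho>" "\<rho> < b" "a < \<rho>'" "\<rho>' < b"
  shows "winding_number (f \<circ> circlepath 0 \<rho>) w = winding_number (f \<circ> circlepath 0 \<rho>') w"
proof (rule winding_number_homotopic_loops)
  show "homotopic_loops (- {w}) (f \<circ> circlepath 0 \<rho>) (f \<circ> circlepath 0 \<rho>')"
    using homotopic_loops_circlepath[of a \<rho> b \<rho>'] assms
    by (intro homotopic_loops_continuous_image[of "open_annulus a b"]) auto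
qed

text \<open>
  The argument principle on the region between two circles. The outer circle minus the inner one is
  not a single path, so the two are joined by a connecting path, run through in both directions,
  which avoids the finitely many zeros of \<open>f - w\<close>. The resulting closed path winds once around each
  point between the circles and not at all around the points outside the larger annulus, so the
  difference of the two winding numbers is the number of zeros, counted with multiplicity.
\<close>

lemma unique_preimage_between_circles:
  assumes holf: "f holomorphic_on open_annulus a b"
    and \<rho>: "0 \<le> a" "a < \<rho>" "\<rho> < \<rho>'" "\<rho>' < b"
    and nz: "\<And>z. norm z = \<rho> \<Longrightarrow> f z \<noteq> w" "\<And>z. norm z = \<rho>' \<Longrightarrow> f z \<noteq> w"
    and wind: "winding_number (f \<circ> circlepath 0 \<rho>') w =
      winding_number (f \<circ> circlepath 0 \<rho>) w + 1"
  shows "\<exists>!z. \<rho> < norm z \<and> norm z < \<rho>' \<and> f z = w"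
proof -
  let ?F = "\<lambda>z. f z - w"
  \<comment> \<open>The argument principle needs finitely many zeros in the whole open set on which it is applied,
    so the annulus is shrunk to one with compact closure in the domain of \<open>f\<close>.\<close>
  define a' b' where "a' = (a + \<rho>) / 2" and "b' = (\<rho>' + b) / 2"
  have ab': "a < a'" "a' < \<rho>" "\<rho>' < b'" "b' < b" "0 < a'" using \<rho> by (auto simp: a'_def b'_def)
  define S where "S = open_annulus a' b'"
  have sub: "S \<subseteq> open_annulus a b" using ab' by (auto simp: S_def open_annulus_def)
  have holF: "?F holomorphic_on S"
    by (intro holomorphic_intros holomorphic_on_subset[OF holf sub])
  \<comment> \<open>A constant \<open>f\<close> would have winding number 0 along both circles.\<close>
  have nconst: "\<not> ?F constant_on open_annulus a b"
  proof
    assume "?F constant_on open_annulus a b"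
    then obtain c where c: "\<And>z. z \<in> open_annulus a b \<Longrightarrow> f z - w = c"
      by (auto simp: constant_on_def)
    have *: "winding_number (f \<circ> circlepath 0 \<sigma>) w = 0" if "\<sigma> \<in> {\<rho>, \<rho>'}" for \<sigma>
    proof -
      have "circlepath 0 \<sigma> t \<in> open_annulus a b" for t
        using that \<rho> by (auto simp: open_annulus_def)
      then have "f \<circ> circlepath 0 \<sigma> = linepath (w + c) (w + c)"
        by (simp add: linepath_def fun_eq_iff algebra_simps scaleR_conv_of_real)
           (metis c add.commute diff_add_cancel)
      moreover have "w + c \<noteq> w"
        using nz(1)[of "of_real \<rho>"] c[of "of_real \<rho>"] \<rho> by (auto simp: open_annulus_def)
      ultimately show ?thesis
        by simp
    qed
    show False using wind *[of \<rho>] *[of \<rho>'] by simp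
  qed
  have "finite {z \<in> {z. a' \<le> norm z \<and> norm z \<le> b'}. ?F z = 0}"
  proof (rule holomorphic_compact_finite_zeros[OF _ _ _ _ _ nconst])
    show "compact {z::complex. a' \<le> norm z \<and> norm z \<le> b'}"
      unfolding compact_eq_bounded_closed
      by (intro conjI closed_Collect_conj closed_Collect_le continuous_intros)
         (rule boundedI[of _ b'], auto)
    show "?F holomorphic_on open_annulus a b" by (intro holomorphic_intros holf)
    show "{z. a' \<le> norm z \<and> norm z \<le> b'} \<subseteq> open_annulus a b"
      using ab' by (auto simp: open_annulus_def)
  qed auto
  then have fin: "finite {z \<in> S. ?F z = 0}"
    by (rule rev_finite_subset) (auto simp: S_def open_annulus_def)
  define Z where "Z = {z \<in> S. ?F z = 0}"
  have "connected (S - Z)"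
    using fin unfolding Z_def S_def by (intro connected_open_delete_finite) auto
  moreover have "open (S - Z)"
    using fin unfolding Z_def S_def by (intro open_Diff finite_imp_closed) auto
  moreover have ends: "of_real \<rho>' \<in> S - Z" "of_real \<rho> \<in> S - Z"
    using \<rho> ab' nz by (auto simp: Z_def S_def open_annulus_def)
  ultimately obtain l where l: "polynomial_function l" "path_image l \<subseteq> S - Z"
      "pathstart l = of_real \<rho>'" "pathfinish l = of_real \<rho>"
    using connected_open_polynomial_connected[of "S - Z" "of_real \<rho>'" "of_real \<rho>"] by auto
  have vl: "valid_path l" using l by (simp add: valid_path_polynomial_function)
  define co ci where "co = circlepath (0::complex) \<rho>'" and "ci = circlepath (0::complex) \<rho>"
  define g where "g = co +++ l +++ reversepath ci +++ reversepath l"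
  have vg: "valid_path g"
    unfolding g_def co_def ci_def using vl l by (intro valid_path_join) auto
  have im: "path_image co \<subseteq> S - Z" "path_image ci \<subseteq> S - Z"
  proof -
    have "z \<in> S - Z" if "norm z = \<rho> \<or> norm z = \<rho>'" for z
      using that \<rho> ab' nz(1)[of z] nz(2)[of z] by (auto simp: Z_def S_def open_annulus_def)
    then show "path_image co \<subseteq> S - Z" "path_image ci \<subseteq> S - Z"
      using \<rho> by (auto simp: co_def ci_def)
  qed
  have img: "path_image g \<subseteq> S - Z"
    unfolding g_def using im l
    by (auto simp: path_image_join co_def ci_def)
  have wg: "winding_number g p = winding_number co p - winding_number ci p"
    if "p \<notin> S - Z" for p
  proof -
    have "p \<notin> path_image co" "p \<notin> path_image ci" "p \<notin> path_image l" using that im l by auto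
    then show ?thesis
      unfolding g_def using l vl
      by (simp add: winding_number_join winding_number_reversepath valid_path_imp_path
          path_image_join co_def ci_def)
  qed
  have wo: "winding_number co p = (if norm p < \<rho>' then 1 else 0)" if "norm p \<noteq> \<rho>'" for p
    using that \<rho> unfolding co_def
    by (auto intro!: winding_number_circlepath winding_number_zero_outside[where s = "cball 0 \<rho>'"]
        simp: valid_path_imp_path)
  have wi: "winding_number ci p = (if norm p < \<rho> then 1 else 0)" if "norm p \<noteq> \<rho>" for p
    using that \<rho> unfolding ci_def
    by (auto intro!: winding_number_circlepath winding_number_zero_outside[where s = "cball 0 \<rho>"]
        simp: valid_path_imp_path)
  have "contour_integral g (\<lambda>z. deriv ?F z * 1 / ?F z) =
      2 * pi * \<i> * (\<Sum>p\<in>{p \<in> S. ?F p = 0 \<or> p \<in> {}}. winding_number g p * 1 * zorder ?F p)"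
  proof (rule argument_principle[OF _ _ _ _ vg])
    show "path_image g \<subseteq> S - {p \<in> S. ?F p = 0 \<or> p \<in> {}}" using img by (simp add: Z_def)
    show "\<forall>p. p \<notin> S \<longrightarrow> winding_number g p = 0"
    proof (intro allI impI)
      fix p assume p: "p \<notin> S"
      then have "norm p \<noteq> \<rho>" "norm p \<noteq> \<rho>'" using ab' \<rho> by (auto simp: S_def open_annulus_def)
      then show "winding_number g p = 0"
        using wg[of p] wo[of p] wi[of p] p \<rho> ab' by (auto simp: S_def open_annulus_def)
    qed
    show "pathfinish g = pathstart g" using l by (simp add: g_def co_def)
  qed (use fin holF in \<open>auto simp: S_def\<close>)
  then have ap: "contour_integral g (\<lambda>z. deriv ?F z / ?F z) =
      2 * pi * \<i> * (\<Sum>p\<in>Z. winding_number g p * zorder ?F p)"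
    by (simp add: Z_def)
  have holq: "(\<lambda>z. deriv ?F z / ?F z) holomorphic_on S - Z"
    using \<open>open (S - Z)\<close>
    by (intro holomorphic_on_divide holomorphic_deriv holomorphic_on_subset[OF holF])
       (auto simp: Z_def)
  note integrable_off_zeros = contour_integrable_holomorphic_simple[OF holq \<open>open (S - Z)\<close>]
  have "contour_integral g (\<lambda>z. deriv ?F z / ?F z) =
      contour_integral co (\<lambda>z. deriv ?F z / ?F z) - contour_integral ci (\<lambda>z. deriv ?F z / ?F z)"
  proof -
    have 1: "(\<lambda>z. deriv ?F z / ?F z) contour_integrable_on co"
            "(\<lambda>z. deriv ?F z / ?F z) contour_integrable_on ci"
            "(\<lambda>z. deriv ?F z / ?F z) contour_integrable_on l"
      using im l vl by (auto intro!: integrable_off_zeros simp: co_def ci_def)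
    have 2: "valid_path co" "valid_path ci" by (auto simp: co_def ci_def)
    show ?thesis
      unfolding g_def using 1 2 vl l
      by (simp add: contour_integral_reversepath contour_integrable_reversepath co_def ci_def)
  qed
  moreover have wF: "contour_integral c (\<lambda>z. deriv ?F z / ?F z) =
      2 * pi * \<i> * winding_number (f \<circ> c) w" if "path_image c \<subseteq> S - Z" "valid_path c" for c
  proof -
    have "contour_integral c (\<lambda>z. deriv ?F z / ?F z) = contour_integral c (\<lambda>z. deriv f z / (f z - w))"
    proof (rule contour_integral_cong)
      fix z assume "z \<in> path_image c"
      then have "f field_differentiable at z"
        using that sub holf holomorphic_on_imp_differentiable_at[OF holf] by auto
      then show "deriv ?F z / ?F z = deriv f z / (f z - w)" by simp
    qed auto
    also have "\<dots> = 2 * pi * \<i> * winding_number (f \<circ> c) w"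
      using that sub
      by (subst winding_number_image[OF holf]) (auto simp: Z_def)
    finally show ?thesis .
  qed
  ultimately have "(\<Sum>p\<in>Z. winding_number g p * zorder ?F p) =
      winding_number (f \<circ> co) w - winding_number (f \<circ> ci) w"
    using ap im wF[of co] wF[of ci]
    by (simp add: co_def ci_def flip: right_diff_distrib)
  then have sum1: "(\<Sum>p\<in>Z. winding_number g p * zorder ?F p) = 1"
    using wind by (simp add: co_def ci_def)
  define Y where "Y = {z. \<rho> < norm z \<and> norm z < \<rho>' \<and> f z = w}"
  \<comment> \<open>The zeros outside the region have winding number 0; those inside have order at least 1, so a
    total of 1 leaves room for a single one.\<close>
  have YZ: "Y \<subseteq> Z" using ab' by (auto simp: Y_def Z_def S_def open_annulus_def)
  have "(\<Sum>p\<in>Z. winding_number g p * zorder ?F p) = (\<Sum>p\<in>Y. of_int (zorder ?F p))"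
  proof (rule sum.mono_neutral_cong_right)
    have np: "norm p \<noteq> \<rho>" "norm p \<noteq> \<rho>'" if "p \<in> Z" for p
      using that nz by (auto simp: Z_def)
    show "\<forall>p\<in>Z - Y. winding_number g p * of_int (zorder ?F p) = 0"
      using np wg wo wi \<rho> by (fastforce simp: Y_def Z_def)
    show "winding_number g p * of_int (zorder ?F p) = of_int (zorder ?F p)" if "p \<in> Y" for p
      using that np[of p] wg[of p] wo[of p] wi[of p] YZ by (auto simp: Y_def)
  qed (use fin YZ in \<open>auto simp: Z_def\<close>)
  with sum1 have "of_int (\<Sum>p\<in>Y. zorder ?F p) = (1::complex)" by simp
  then have sumY: "(\<Sum>p\<in>Y. zorder ?F p) = 1" by (metis of_int_eq_1_iff)
  have finY: "finite Y" using fin YZ finite_subset by (auto simp: Z_def)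
  have pos: "zorder ?F p \<ge> 1" if "p \<in> Y" for p
  proof -
    have "\<exists>z\<in>S. ?F z \<noteq> 0" using ends by (auto simp: Z_def)
    then have "zorder ?F p > 0"
      using zorder_exist_zero[of ?F S p] holF that YZ by (auto simp: Z_def S_def Y_def)
    then show ?thesis by simp
  qed
  have "int (card Y) \<le> (\<Sum>p\<in>Y. zorder ?F p)"
    using sum_mono[of Y "\<lambda>_. 1" "zorder ?F"] pos by simp
  moreover have "Y \<noteq> {}" using sumY by auto
  then have "card Y > 0" using finY by (simp add: card_gt_0_iff)
  ultimately have "card Y = 1" using sumY by linarith
  then obtain p where "Y = {p}" by (auto simp: card_1_singleton_iff)
  then have "\<rho> < norm z \<and> norm z < \<rho>' \<and> f z = w \<longleftrightarrow> z = p" for z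
    unfolding Y_def by blast
  then show ?thesis by (intro ex1I[of _ p]) auto
qed

section \<open>Means of logarithms over circles\<close>

definition circle_log_mean :: "(complex \<Rightarrow> complex) \<Rightarrow> real \<Rightarrow> real"
  where "circle_log_mean h \<rho> = integral {0..1} (\<lambda>t. ln (norm (h (circlepath 0 \<rho> t))))"

lemma has_real_derivative_ln_norm:
  fixes u :: "real \<Rightarrow> complex"
  assumes "(u has_vector_derivative u') (at x)" "u x \<noteq> 0"
  shows "((\<lambda>x. ln (norm (u x))) has_real_derivative Re (u' / u x)) (at x)"
proof -
  define p q where "p = (\<lambda>x. Re (u x))" and "q = (\<lambda>x. Im (u x))"
  have pq: "(p has_real_derivative Re u') (at x)" "(q has_real_derivative Im u') (at x)"
    using assms(1) unfolding p_def q_def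
    by (auto simp: has_real_derivative_iff_has_vector_derivative
        intro: bounded_linear.has_vector_derivative[OF bounded_linear_Re]
          bounded_linear.has_vector_derivative[OF bounded_linear_Im])
  have pos: "0 < (p x)\<^sup>2 + (q x)\<^sup>2"
    using assms(2) by (simp add: complex_neq_0 p_def q_def)
  have "((\<lambda>x. ln ((p x)\<^sup>2 + (q x)\<^sup>2)) has_real_derivative
      (2 * p x * Re u' + 2 * q x * Im u') / ((p x)\<^sup>2 + (q x)\<^sup>2)) (at x)"
    using pos by (auto intro!: derivative_eq_intros pq)
  from DERIV_cdivide[OF this, of 2]
  have "((\<lambda>x. ln ((p x)\<^sup>2 + (q x)\<^sup>2) / 2) has_real_derivative
      (2 * p x * Re u' + 2 * q x * Im u') / ((p x)\<^sup>2 + (q x)\<^sup>2) / 2) (at x)" .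
  also have "(2 * p x * Re u' + 2 * q x * Im u') / ((p x)\<^sup>2 + (q x)\<^sup>2) / 2 = Re (u' / u x)"
  proof -
    have half: "X = 2 * Y \<Longrightarrow> X / P / 2 = Y / P" for X Y P :: real by simp
    show ?thesis
      unfolding Re_divide p_def q_def by (rule half) simp
  qed
  finally have "((\<lambda>x. ln ((Re (u x))\<^sup>2 + (Im (u x))\<^sup>2) / 2) has_real_derivative Re (u' / u x)) (at x)"
    by (simp add: p_def q_def)
  moreover have "ln (norm (u x)) = ln ((Re (u x))\<^sup>2 + (Im (u x))\<^sup>2) / 2" if "u x \<noteq> 0" for x
    using that by (simp add: cmod_def ln_sqrt complex_neq_0)
  moreover have "\<forall>\<^sub>F x in nhds x. u x \<noteq> 0"
    using has_vector_derivative_continuous[OF assms(1)] assms(2)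
    by (intro tendsto_imp_eventually_ne[where c = "u x"])
       (auto simp: isCont_def tendsto_at_iff_tendsto_nhds)
  ultimately show ?thesis
    by (subst DERIV_cong_ev[OF refl _ refl]) (auto elim: eventually_mono)
qed

text \<open>
  Differentiating \<open>ln |h (\<rho> e\<^sup>i\<^sup>t)|\<close> in \<open>\<rho>\<close> gives the real part of \<open>e\<^sup>i\<^sup>t h'/h\<close>, whose mean over the
  circle is, up to the factor \<open>\<rho>\<close>, the contour integral that computes the winding number of the
  image of the circle.
\<close>

lemma circle_log_mean_has_derivative:
  assumes hol: "h holomorphic_on open_annulus a b"
    and nz: "\<And>z. z \<in> open_annulus a b \<Longrightarrow> h z \<noteq> 0"
    and \<rho>: "0 \<le> a" "a < \<rho>" "\<rho> < b"
  shows "(circle_log_mean h has_real_derivative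
    Re (winding_number (h \<circ> circlepath 0 \<rho>) 0) / \<rho>) (at \<rho>)"
proof -
  define e where "e = (\<lambda>t::real. exp (2 * of_real pi * \<i> * of_real t))"
  define A where "A = open_annulus a b"
  have inA: "of_real x * e t \<in> A" if "x \<in> {a<..<b}" for x t
    using that \<rho> by (simp add: A_def open_annulus_def e_def norm_mult)
  have cp: "circlepath 0 x t = of_real x * e t" for x t by (simp add: circlepath e_def)
  define D where "D = (\<lambda>x t. deriv h (of_real x * e t) * e t / h (of_real x * e t))"
  have conth: "continuous_on A h" "continuous_on A (deriv h)"
    using hol by (auto simp: A_def intro!: holomorphic_on_imp_continuous_on holomorphic_deriv)
  have conte: "continuous_on X e" for X unfolding e_def by (intro continuous_intros)
  have der: "((\<lambda>x. ln (norm (h (of_real x * e t)))) has_real_derivative Re (D x t)) (at x)"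
    if "x \<in> {a<..<b}" for x t
  proof -
    have "(h has_field_derivative deriv h (of_real x * e t)) (at (of_real x * e t))"
      using hol inA[OF that] by (auto simp: A_def intro!: holomorphic_derivI)
    moreover have "((\<lambda>x. of_real x * e t) has_vector_derivative e t) (at x)"
      by (auto intro!: derivative_eq_intros)
    ultimately have "((h \<circ> (\<lambda>x. of_real x * e t)) has_vector_derivative
        e t * deriv h (of_real x * e t)) (at x)"
      by (intro field_vector_diff_chain_at)
    then show ?thesis
      using has_real_derivative_ln_norm[of "h \<circ> (\<lambda>x. of_real x * e t)"] nz inA[OF that]
      by (simp add: o_def D_def A_def mult.commute)
  qed
  have contx: "continuous_on {0..1} (\<lambda>t. ln (norm (h (of_real x * e t))))" if "x \<in> {a<..<b}" for x
    using inA[OF that] nz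
    by (intro continuous_intros continuous_on_compose2[OF conth(1)] conte) (auto simp: A_def)
  have contD: "continuous_on ({a<..<b} \<times> {0..1}) (\<lambda>(x, t). D x t)"
    unfolding D_def split_def using inA nz
    by (intro continuous_intros continuous_on_compose2[OF conth(1)]
        continuous_on_compose2[OF conth(2)] continuous_on_compose2[OF conte]) (auto simp: A_def)
  have "((\<lambda>x. integral (cbox 0 1) (\<lambda>t. ln (norm (h (of_real x * e t)))))
      has_field_derivative integral (cbox 0 1) (\<lambda>t. Re (D \<rho> t))) (at \<rho> within {a<..<b})"
  proof (rule leibniz_rule_field_derivative)
    show "continuous_on ({a<..<b} \<times> cbox 0 1) (\<lambda>(x, t). Re (D x t))"
      using continuous_on_Re[OF contD] by (simp add: split_def)
  qed (use der contx \<rho> in \<open>auto intro: integrable_continuous_real has_field_derivative_at_within\<close>)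
  then have "(circle_log_mean h has_real_derivative integral {0..1} (\<lambda>t. Re (D \<rho> t))) (at \<rho>)"
    using \<rho> by (simp add: circle_log_mean_def[abs_def] cp at_within_open[of \<rho> "{a<..<b}"])
  also have "integral {0..1} (\<lambda>t. Re (D \<rho> t)) = Re (integral {0..1} (D \<rho>))"
  proof -
    have "continuous_on {0..1} (D \<rho>)"
      using continuous_on_compose2[OF contD, of "{0..1}" "\<lambda>t. (\<rho>, t)"] \<rho>
      by (simp add: continuous_on_Pair image_subset_iff)
    then have "D \<rho> integrable_on {0..1}" by (rule integrable_continuous_real)
    then show ?thesis
      by (intro integral_unique has_integral_Re integrable_integral)
  qed
  also have "integral {0..1} (D \<rho>) = winding_number (h \<circ> circlepath 0 \<rho>) 0 / \<rho>"
  proof -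
    have "winding_number (h \<circ> circlepath 0 \<rho>) 0 =
        1 / (2 * pi * \<i>) * contour_integral (circlepath 0 \<rho>) (\<lambda>z. deriv h z / (h z - 0))"
      using \<rho> nz by (intro winding_number_image[OF hol open_open_annulus])
        (auto simp: open_annulus_def)
    also have "\<dots> = 1 / (2 * pi * \<i>) * integral {0..1} (\<lambda>t. 2 * pi * \<i> * \<rho> * D \<rho> t)"
      by (simp add: contour_integral_integral vector_derivative_circlepath cp D_def e_def mult_ac)
    also have "\<dots> = \<rho> * integral {0..1} (D \<rho>)" by simp
    finally show ?thesis using \<rho> by simp
  qed
  also have "Re (winding_number (h \<circ> circlepath 0 \<rho>) 0 / \<rho>) =
      Re (winding_number (h \<circ> circlepath 0 \<rho>) 0) / \<rho>" by simp
  finally show ?thesis .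
qed

text \<open>
  The winding number is an integer and, by homotopy, the same for all circles in the annulus, so the
  derivative just computed is \<open>n / \<rho>\<close>. The upper bound for squeezing ratios rests on \<open>n\<close> being an
  integer: this excludes the values strictly between -1 and 0.
\<close>

lemma circle_log_mean_eq:
  assumes hol: "h holomorphic_on open_annulus a b"
    and nz: "\<And>z. z \<in> open_annulus a b \<Longrightarrow> h z \<noteq> 0"
    and "0 \<le> a" "a < b"
  obtains n :: int and c :: real
  where "\<And>\<rho>. a < \<rho> \<Longrightarrow> \<rho> < b \<Longrightarrow> circle_log_mean h \<rho> = of_int n * ln \<rho> + c"
proof -
  define m where "m = (a + b) / 2"
  have m: "a < m" "m < b" using assms by (auto simp: m_def)
  have "winding_number (h \<circ> circlepath 0 m) 0 \<in> \<int>"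
  proof (rule integer_winding_number)
    show "path (h \<circ> circlepath 0 m)"
      using hol m \<open>0 \<le> a\<close>
      by (intro valid_path_imp_path valid_path_compose_holomorphic[OF _ hol open_open_annulus])
         (auto simp: open_annulus_def)
    show "0 \<notin> path_image (h \<circ> circlepath 0 m)"
      using nz m \<open>0 \<le> a\<close> by (fastforce simp: path_image_compose open_annulus_def)
  qed (simp add: pathfinish_compose pathstart_compose)
  then obtain n where n: "winding_number (h \<circ> circlepath 0 m) 0 = of_int n"
    by (auto elim: Ints_cases)
  define d where "d = (\<lambda>\<rho>. circle_log_mean h \<rho> - of_int n * ln \<rho>)"
  have "(d has_real_derivative 0) (at \<rho> within {a<..<b})" if "\<rho> \<in> {a<..<b}" for \<rho>
  proof -
    have "winding_number (h \<circ> circlepath 0 \<rho>) 0 = of_int n"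
      using winding_number_image_circle_eq[of a b h 0 \<rho> m] that m nz n \<open>0 \<le> a\<close>
        holomorphic_on_imp_continuous_on[OF hol] by simp
    then have "(circle_log_mean h has_real_derivative of_int n / \<rho>) (at \<rho>)"
      using circle_log_mean_has_derivative[OF hol nz, of \<rho>] that \<open>0 \<le> a\<close> by simp
    moreover have "((\<lambda>\<rho>. of_int n * ln \<rho>) has_real_derivative of_int n / \<rho>) (at \<rho>)"
      using that \<open>0 \<le> a\<close> by (auto intro!: derivative_eq_intros)
    ultimately have "(d has_real_derivative of_int n / \<rho> - of_int n / \<rho>) (at \<rho>)"
      unfolding d_def by (rule DERIV_diff)
    then show ?thesis by (simp add: has_field_derivative_at_within)
  qed
  then obtain c where "\<And>\<rho>. \<rho> \<in> {a<..<b} \<Longrightarrow> d \<rho> = c"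
    using has_field_derivative_zero_constant[of "{a<..<b}" d] by auto
  then have "circle_log_mean h \<rho> = of_int n * ln \<rho> + c" if "a < \<rho>" "\<rho> < b" for \<rho>
    using that by (force simp: d_def algebra_simps)
  then show ?thesis using that by blast
qed

lemma has_integral_circle_mean:
  assumes "F holomorphic_on cball 0 \<rho>" "0 < \<rho>"
  shows "((\<lambda>t. F (circlepath 0 \<rho> t)) has_integral F 0) {0..1}"
proof -
  have "((\<lambda>u. F u / (u - 0)) has_contour_integral 2 * of_real pi * \<i> * F 0) (circlepath 0 \<rho>)"
    using assms by (intro Cauchy_integral_circlepath_simple) auto
  then have "((\<lambda>t. F (circlepath 0 \<rho> t) / circlepath 0 \<rho> t *
      (2 * pi * \<i> * \<rho> * exp (2 * of_real pi * \<i> * t))) has_integral 2 * of_real pi * \<i> * F 0) {0..1}"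
    by (simp add: has_contour_integral vector_derivative_circlepath)
  also have "(\<lambda>t. F (circlepath 0 \<rho> t) / circlepath 0 \<rho> t *
      (2 * pi * \<i> * \<rho> * exp (2 * of_real pi * \<i> * t))) = (\<lambda>t. 2 * of_real pi * \<i> * F (circlepath 0 \<rho> t))"
    using assms by (simp add: circlepath fun_eq_iff)
  finally have "((\<lambda>t. 2 * of_real pi * \<i> * F (circlepath 0 \<rho> t)) has_integral
      2 * of_real pi * \<i> * F 0) {0..1}" .
  from has_integral_mult_right[OF this, of "1 / (2 * of_real pi * \<i>)"]
  show ?thesis by simp
qed

text \<open>
  Jensen's formula for a single zero. If the zero lies outside the circle, \<open>ln |1 - z / p|\<close> is harmonic
  in the disc and vanishes at its centre. If it lies inside, it can be replaced by its mirror image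
  \<open>\<rho>\<^sup>2 / cnj p\<close> in the circle, because \<open>|z - p| = \<rho> |1 - z cnj p / \<rho>\<^sup>2|\<close> when \<open>|z| = \<rho>\<close>.
\<close>

lemma circle_log_mean_linear:
  assumes "0 < \<rho>" "norm p \<noteq> \<rho>" "p \<noteq> 0"
  shows "circle_log_mean (\<lambda>z. z - p) \<rho> = ln (max \<rho> (norm p))"
proof -
  have key: "((\<lambda>t. ln (norm (1 - circlepath 0 \<rho> t / q))) has_integral 0) {0..1}"
    if q: "\<rho> < norm q" for q
  proof -
    have "Re (1 - z / q) > 0" if "z \<in> cball 0 \<rho>" for z
    proof -
      have "norm (z / q) < 1" using that q assms by (auto simp: norm_divide divide_simps)
      then show ?thesis using complex_Re_le_cmod[of "z / q"] by simp
    qed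
    then have "(\<lambda>z. Ln (1 - z / q)) holomorphic_on cball 0 \<rho>"
      using q assms by (intro holomorphic_intros) (auto simp: complex_nonpos_Reals_iff not_less[symmetric])
    from has_integral_circle_mean[OF this \<open>0 < \<rho>\<close>]
    have "((\<lambda>t. Ln (1 - circlepath 0 \<rho> t / q)) has_integral 0) {0..1}" by simp
    then have "((\<lambda>t. Re (Ln (1 - circlepath 0 \<rho> t / q))) has_integral 0) {0..1}"
      by (drule_tac has_integral_Re) simp
    moreover have "1 - circlepath 0 \<rho> t / q \<noteq> 0" for t
    proof
      assume "1 - circlepath 0 \<rho> t / q = 0"
      then have "circlepath 0 \<rho> t = q" using q assms by (auto simp: field_simps)
      then show False using q assms norm_circlepath_0[of \<rho> t] by auto
    qed
    ultimately show ?thesis by (simp add: Re_Ln)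
  qed
  have "((\<lambda>t. ln (norm (circlepath 0 \<rho> t - p))) has_integral ln (max \<rho> (norm p))) {0..1}"
  proof (cases "\<rho> < norm p")
    case True
    have "norm (circlepath 0 \<rho> t - p) = norm p * norm (1 - circlepath 0 \<rho> t / p)" for t
    proof -
      have "circlepath 0 \<rho> t - p = - (p * (1 - circlepath 0 \<rho> t / p))"
        using assms by (simp add: field_simps)
      then show ?thesis by (simp only: norm_minus_cancel norm_mult)
    qed
    moreover have "1 - circlepath 0 \<rho> t / p \<noteq> 0" for t
      using True assms norm_circlepath_0[of \<rho> t] by (auto simp: field_simps)
    ultimately have "ln (norm (circlepath 0 \<rho> t - p)) = ln (norm p) + ln (norm (1 - circlepath 0 \<rho> t / p))" for t
      using assms by (simp add: ln_mult)
    then show ?thesis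
      using has_integral_add[OF has_integral_const_real[of "ln (norm p)" 0 1] key[OF True]] True by simp
  next
    case False
    define q where "q = of_real (\<rho>\<^sup>2) / cnj p"
    have q: "\<rho> < norm q"
      using False assms by (simp add: q_def norm_divide norm_mult field_simps power2_eq_square)
    have "norm (circlepath 0 \<rho> t - p) = \<rho> * norm (1 - circlepath 0 \<rho> t / q)" for t
    proof -
      let ?z = "circlepath 0 \<rho> t"
      have zz: "?z * cnj ?z = of_real (\<rho>\<^sup>2)"
        by (simp flip: complex_norm_square)
      have "cnj ?z \<noteq> 0" using norm_circlepath_0[of \<rho> t] assms by auto
      have "cnj (?z - p) * ?z = of_real (\<rho>\<^sup>2) * (1 - ?z / q)"
        using zz assms by (simp add: q_def field_simps)
      from arg_cong[OF this, of norm] show ?thesis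
        using assms by (simp add: norm_mult power2_eq_square del: complex_cnj_diff)
    qed
    moreover have "1 - circlepath 0 \<rho> t / q \<noteq> 0" for t
      using q assms norm_circlepath_0[of \<rho> t] by (auto simp: field_simps)
    ultimately have "ln (norm (circlepath 0 \<rho> t - p)) = ln \<rho> + ln (norm (1 - circlepath 0 \<rho> t / q))" for t
      using assms by (simp add: ln_mult)
    then show ?thesis
      using has_integral_add[OF has_integral_const_real[of "ln \<rho>" 0 1] key[OF q]] False by simp
  qed
  then show ?thesis by (simp add: circle_log_mean_def integral_unique)
qed

section \<open>Upper bound for squeezing ratios\<close>

text \<open>
  An injective holomorphic map is a homeomorphism onto its image, so the preimage of a closed disc
  inside the image is compact and stays away from both boundary circles.
\<close>

lemma embedding_large_near_boundary:
  assumes r: "0 < r" "r < 1" and hol: "f holomorphic_on annulus r" and inj: "inj_on f (annulus r)"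
    and sub: "ball 0 a \<subseteq> f ` annulus r" and a': "0 < a'" "a' < a"
  obtains \<rho>\<^sub>1 \<rho>\<^sub>2 where "r < \<rho>\<^sub>1" "\<rho>\<^sub>2 < 1"
    "\<And>z. z \<in> annulus r \<Longrightarrow> norm z < \<rho>\<^sub>1 \<or> \<rho>\<^sub>2 < norm z \<Longrightarrow> a' < norm (f z)"
proof -
  have op: "open (annulus r)" by (simp add: annulus_eq_open_annulus)
  obtain g where g: "g holomorphic_on f ` annulus r" 
      "\<And>z. z \<in> annulus r \<Longrightarrow> deriv f z * deriv g (f z) = 1"
      "\<And>z. z \<in> annulus r \<Longrightarrow> g (f z) = z"
    by (rule holomorphic_has_inverse[OF hol op inj]) (rule that, assumption+)
  define K where "K = g ` cball 0 a'"
  have subc: "cball 0 a' \<subseteq> f ` annulus r"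
  proof -
    have "cball (0::complex) a' \<subseteq> ball 0 a" using a' by auto
    then show ?thesis using sub by (rule subset_trans)
  qed
  have "compact K"
    unfolding K_def
    using continuous_on_subset[OF holomorphic_on_imp_continuous_on[OF g(1)] subc] compact_cball
    by (rule compact_continuous_image)
  have "K \<noteq> {}" using a' by (simp add: K_def)
  have KA: "K \<subseteq> annulus r"
  proof
    fix x assume "x \<in> K"
    then obtain w where w: "x = g w" "w \<in> cball 0 a'" by (auto simp: K_def)
    with subc obtain z where "z \<in> annulus r" "w = f z" by blast
    then show "x \<in> annulus r" using g(3) w by simp
  qed
  have contn: "continuous_on K norm" by (intro continuous_intros)
  obtain z\<^sub>1 where z1: "z\<^sub>1 \<in> K" "\<And>z. z \<in> K \<Longrightarrow> norm z\<^sub>1 \<le> norm z"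
    using continuous_attains_inf[OF \<open>compact K\<close> \<open>K \<noteq> {}\<close> contn] by blast
  obtain z\<^sub>2 where z2: "z\<^sub>2 \<in> K" "\<And>z. z \<in> K \<Longrightarrow> norm z \<le> norm z\<^sub>2"
    using continuous_attains_sup[OF \<open>compact K\<close> \<open>K \<noteq> {}\<close> contn] by blast
  show ?thesis
  proof (rule that[of "norm z\<^sub>1" "norm z\<^sub>2"])
    show "a' < norm (f z)" if z: "z \<in> annulus r" "norm z < norm z\<^sub>1 \<or> norm z\<^sub>2 < norm z" for z
    proof (rule ccontr)
      assume "\<not> a' < norm (f z)"
      then have "g (f z) \<in> K" unfolding K_def by (intro imageI) auto
      then show False using z g(3)[OF z(1)] z1(2)[of z] z2(2)[of z] by auto
    qed
  qed (use z1(1) z2(1) KA in \<open>auto simp: annulus_def\<close>)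
qed

text \<open>
  In the application \<open>(z - p) h z\<close> is the value at \<open>z\<close> of an embedding that vanishes at \<open>p\<close>. The mean of
  the logarithm of its modulus is that of \<open>h\<close> plus the explicit contribution of the zero.
\<close>

lemma circle_log_mean_factor_bounds:
  assumes hol: "h holomorphic_on annulus r" and nz: "\<And>z. z \<in> annulus r \<Longrightarrow> h z \<noteq> 0"
    and \<rho>: "0 < r" "r < \<rho>" "\<rho> < 1" "norm p \<noteq> \<rho>" "p \<noteq> 0" and a: "0 < a"
    and bd: "\<And>z. norm z = \<rho> \<Longrightarrow> a \<le> norm ((z - p) * h z) \<and> norm ((z - p) * h z) \<le> b"
  shows "ln a \<le> circle_log_mean h \<rho> + ln (max \<rho> (norm p))"
    and "circle_log_mean h \<rho> + ln (max \<rho> (norm p)) \<le> ln b"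
proof -
  let ?c = "circlepath (0::complex) \<rho>"
  have cA: "?c t \<in> annulus r" and cp: "?c t - p \<noteq> 0" for t
    using \<rho> norm_circlepath_0[of \<rho> t] by (auto simp: annulus_def)
  have contc: "continuous_on {0..1} ?c"
    using valid_path_imp_path[OF valid_path_circlepath] by (simp add: path_def)
  have "continuous_on {0..1} (\<lambda>t. h (?c t))"
    using cA by (intro continuous_on_compose2[OF holomorphic_on_imp_continuous_on[OF hol] contc]) auto
  then have int: "(\<lambda>t. ln (norm (h (?c t)))) integrable_on {0..1}"
      "(\<lambda>t. ln (norm (?c t - p))) integrable_on {0..1}"
    using cA nz cp by (auto intro!: integrable_continuous_real continuous_intros contc)
  have eq: "ln (norm (h (?c t))) + ln (norm (?c t - p)) = ln (norm ((?c t - p) * h (?c t)))" for t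
    using cA[of t] nz cp[of t] by (simp add: norm_mult ln_mult)
  have "circle_log_mean h \<rho> + ln (max \<rho> (norm p)) =
      circle_log_mean h \<rho> + circle_log_mean (\<lambda>z. z - p) \<rho>"
    using \<rho> by (simp add: circle_log_mean_linear)
  also have "((\<lambda>t. ln (norm (h (?c t))) + ln (norm (?c t - p))) has_integral \<dots>) {0..1}"
    unfolding circle_log_mean_def using int by (intro has_integral_add integrable_integral)
  finally have I: "((\<lambda>t. ln (norm ((?c t - p) * h (?c t)))) has_integral
      circle_log_mean h \<rho> + ln (max \<rho> (norm p))) {0..1}"
    by (simp only: eq)
  have bd': "a \<le> norm ((?c t - p) * h (?c t))" "norm ((?c t - p) * h (?c t)) \<le> b" for t
    using bd[of "?c t"] \<rho> by auto
  show "ln a \<le> circle_log_mean h \<rho> + ln (max \<rho> (norm p))"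
    using bd'(1) a
    by (intro has_integral_le[OF _ I, of "\<lambda>_. ln a"])
       (use has_integral_const_real[of "ln a" 0 1] in \<open>auto intro!: ln_mono intro: less_le_trans\<close>)
  show "circle_log_mean h \<rho> + ln (max \<rho> (norm p)) \<le> ln b"
    using bd' a
    by (intro has_integral_le[OF I, of "\<lambda>_. ln b"])
       (use has_integral_const_real[of "ln b" 0 1] in \<open>auto intro!: ln_mono intro: less_le_trans\<close>)
qed

text \<open>
  With \<open>f z = (z - p) h z\<close>, the mean of \<open>ln |f|\<close> over the circle of radius \<open>\<rho>\<close> is
  \<open>\<phi> \<rho> = n ln \<rho> + c + ln (max \<rho> |p|)\<close> with an integer \<open>n\<close>. Near either boundary circle the modulus of
  \<open>f\<close> lies between every \<open>a' < a\<close> and \<open>b\<close>, so both limits \<open>\<phi> r = n ln r + c + ln |p|\<close> and \<open>\<phi> 1 = c\<close> lie in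
  \<open>[ln a', ln b]\<close>. If \<open>n \<ge> 0\<close>, then \<open>ln a' \<le> \<phi> r \<le> ln |p| + \<phi> 1\<close> and \<open>a' \<le> b |p|\<close>. If \<open>n \<le> -1\<close>, then
  \<open>ln a' \<le> \<phi> 1 = \<phi> r - n ln r - ln |p| \<le> ln b + ln r - ln |p|\<close> and \<open>a' \<le> b r / |p|\<close>. The two
  cases are those in which the outer boundary of the image corresponds to the unit circle and to the
  circle of radius \<open>r\<close>, respectively.
\<close>

lemma squeezing_ratio_upper_bound:
  assumes r: "0 < r" "r < norm p" "norm p < 1"
    and emb: "f \<in> embeddings_at (annulus r) p"
    and ab: "0 < a" "0 < b" "ball 0 a \<subseteq> f ` annulus r" "f ` annulus r \<subseteq> ball 0 b"
  shows "a / b \<le> max (norm p) (r / norm p)"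
proof -
  have hol: "f holomorphic_on annulus r" and inj: "inj_on f (annulus r)" and f0: "f p = 0"
    using emb by (auto simp: embeddings_at_def)
  have pA: "p \<in> annulus r" and p0: "p \<noteq> 0" using r by (auto simp: annulus_def)
  have op: "open (annulus r)" by (simp add: annulus_eq_open_annulus)
  define h where "h = (\<lambda>z. if z = p then deriv f p else (f z - f p) / (z - p))"
  have holh: "h holomorphic_on annulus r"
    unfolding h_def using hol pA op by (intro pole_lemma) (simp_all add: interior_open)
  have nzh: "h z \<noteq> 0" if "z \<in> annulus r" for z
    using that inj_onD[OF inj _ that pA] holomorphic_injective_imp_regular[OF hol op inj pA]
    by (auto simp: h_def)
  have fh: "f z = (z - p) * h z" for z by (simp add: h_def f0)
  obtain n c where nc: "\<And>\<rho>. r < \<rho> \<Longrightarrow> \<rho> < 1 \<Longrightarrow> circle_log_mean h \<rho> = of_int n * ln \<rho> + c"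
    using circle_log_mean_eq[of h r 1] holh nzh r by (auto simp: annulus_eq_open_annulus)
  have "a' \<le> b * max (norm p) (r / norm p)" if a': "0 < a'" "a' < a" for a'
  proof -
    obtain \<rho>\<^sub>1 \<rho>\<^sub>2 where \<rho>12: "r < \<rho>\<^sub>1" "\<rho>\<^sub>2 < 1"
      and far: "\<And>z. z \<in> annulus r \<Longrightarrow> norm z < \<rho>\<^sub>1 \<or> \<rho>\<^sub>2 < norm z \<Longrightarrow> a' < norm (f z)"
      using embedding_large_near_boundary[OF _ _ hol inj ab(3) a'] r by auto
    have bounds: "ln a' \<le> of_int n * ln \<rho> + c + ln (max \<rho> (norm p)) \<and>
        of_int n * ln \<rho> + c + ln (max \<rho> (norm p)) \<le> ln b"
      if "r < \<rho>" "\<rho> < 1" "\<rho> < \<rho>\<^sub>1 \<or> \<rho>\<^sub>2 < \<rho>" "\<rho> \<noteq> norm p" for \<rho>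
    proof -
      have "a' \<le> norm ((z - p) * h z) \<and> norm ((z - p) * h z) \<le> b" if "norm z = \<rho>" for z
      proof -
        have zA: "z \<in> annulus r" using that \<open>r < \<rho>\<close> \<open>\<rho> < 1\<close> by (simp add: annulus_def)
        moreover have "norm (f z) < b" using ab(4) zA by auto
        ultimately show ?thesis using far[OF zA] that \<open>\<rho> < \<rho>\<^sub>1 \<or> \<rho>\<^sub>2 < \<rho>\<close> fh[of z] by auto
      qed
      then show ?thesis
        using circle_log_mean_factor_bounds[OF holh nzh, of \<rho> p a' b] that r p0 a' nc[of \<rho>] by auto
    qed
    define \<phi> where "\<phi> = (\<lambda>\<rho>. of_int n * ln \<rho> + c + ln (max \<rho> (norm p)))"
    have lim: "(\<phi> \<longlongrightarrow> \<phi> x) (at x within S)" if "x > 0" for x S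
      unfolding \<phi>_def using that by (intro tendsto_intros) auto
    have evr: "\<forall>\<^sub>F \<rho> in at_right r. ln a' \<le> \<phi> \<rho> \<and> \<phi> \<rho> \<le> ln b"
      unfolding \<phi>_def using \<rho>12 r
      by (intro eventually_at_rightI[of r "min \<rho>\<^sub>1 (norm p)"] bounds) auto
    have ev1: "\<forall>\<^sub>F \<rho> in at_left 1. ln a' \<le> \<phi> \<rho> \<and> \<phi> \<rho> \<le> ln b"
      unfolding \<phi>_def using \<rho>12 r
      by (intro eventually_at_leftI[of "max \<rho>\<^sub>2 (norm p)" 1] bounds) auto
    have "ln a' \<le> \<phi> r" "\<phi> r \<le> ln b"
      using lim[of r "{r<..}"] evr r
      by (auto intro: tendsto_lowerbound tendsto_upperbound elim: eventually_mono)
    then have A: "ln a' \<le> of_int n * ln r + c + ln (norm p)"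
        "of_int n * ln r + c + ln (norm p) \<le> ln b"
      using r by (auto simp: \<phi>_def max_def)
    have "ln a' \<le> \<phi> 1" "\<phi> 1 \<le> ln b"
      using lim[of 1 "{..<1}"] ev1
      by (auto intro: tendsto_lowerbound tendsto_upperbound elim: eventually_mono)
    then have B: "ln a' \<le> c" "c \<le> ln b"
      using r by (auto simp: \<phi>_def max_def)
    have lnr: "ln r < 0" using r by simp
    show ?thesis
    proof (cases "n \<ge> 0")
      case True
      then have "of_int n * ln r \<le> 0" using lnr by (simp add: mult_nonneg_nonpos)
      then have "ln a' \<le> ln (b * norm p)"
        using A B ab p0 by (simp add: ln_mult)
      then have "a' \<le> b * norm p" using a' ab p0 by simp
      then show ?thesis using ab by (simp add: max_mult_distrib_left le_max_iff_disj)
    next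
      case False
      then have "of_int n \<le> (-1 :: real)" by linarith
      then have "- ln r \<le> of_int n * ln r"
        using lnr mult_right_mono_neg[of "of_int n" "-1" "ln r"] by simp
      then have "ln a' \<le> ln (b * (r / norm p))"
        using A B ab p0 r by (simp add: ln_mult ln_div)
      then have "a' \<le> b * (r / norm p)" using a' ab p0 r by (subst (asm) ln_le_cancel_iff) auto
      then show ?thesis using ab by (simp add: max_mult_distrib_left le_max_iff_disj)
    qed
  qed
  then have "a \<le> b * max (norm p) (r / norm p)"
    using ab(1) by (rule_tac dense_le_bounded[of 0]) auto
  then show ?thesis using ab by (simp add: divide_le_eq mult.commute)
qed

section \<open>Embeddings determined by their boundary values\<close>

text \<open>
  A map that sends the unit circle into itself with winding number 1, and the inner circle into the
  circle of radius \<open>s\<close> with winding number 0, is injective on the annulus, and its image is the unit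
  disc up to points of modulus \<open>s\<close>. Indeed a value \<open>w\<close> of modulus below 1 other than \<open>s\<close> is not taken
  on the boundary; the outer winding number around it is 1 and the inner one is 0, because \<open>w\<close> can be
  moved to 0 or to infinity without meeting the inner image curve. So \<open>w\<close> is taken exactly once. Values of modulus \<open>s\<close>
  cannot be taken twice either: by the open mapping theorem, nearby values of other moduli would also
  be taken twice.
\<close>

lemma embedding_by_boundary_values:
  assumes hol: "f holomorphic_on open_annulus a b"
    and r: "0 \<le> a" "a < r" "r < 1" "1 < b" and s: "s < 1"
    and outer: "\<And>z. norm z = 1 \<Longrightarrow> norm (f z) = 1"
    and inner: "\<And>z. norm z = r \<Longrightarrow> norm (f z) = s"
    and wind_outer: "winding_number (f \<circ> circlepath 0 1) 0 = 1"
    and wind_inner: "winding_number (f \<circ> circlepath 0 r) 0 = 0"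
  shows "inj_on f (annulus r)" "ball 0 s \<subseteq> f ` annulus r" "f ` annulus r \<subseteq> ball 0 1"
proof -
  let ?A = "annulus r"
  have sub: "?A \<subseteq> open_annulus a b" using r by (auto simp: annulus_def open_annulus_def)
  have holA: "f holomorphic_on ?A" using hol sub by (rule holomorphic_on_subset)
  have opA: "open ?A" and connA: "connected ?A" by (simp_all add: annulus_eq_open_annulus)
  have path: "path (f \<circ> circlepath 0 \<rho>)" if "a < \<rho>" "\<rho> < b" for \<rho>
    using that r
    by (intro valid_path_imp_path valid_path_compose_holomorphic[OF _ hol open_open_annulus])
       (auto simp: open_annulus_def)
  have im_outer: "path_image (f \<circ> circlepath 0 1) \<subseteq> sphere 0 1"
    using outer by (auto simp: path_image_compose)
  have im_inner: "path_image (f \<circ> circlepath 0 r) \<subseteq> sphere 0 s"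
    using inner r by (auto simp: path_image_compose)
  have s0: "0 \<le> s" using inner[of "of_real r"] r by auto
  have once: "\<exists>!z. r < norm z \<and> norm z < 1 \<and> f z = w" if w: "norm w < 1" "norm w \<noteq> s" for w
  proof (rule unique_preimage_between_circles[OF hol])
    have "winding_number (f \<circ> circlepath 0 1) w = winding_number (f \<circ> circlepath 0 1) 0"
      using path[of 1] r w im_outer
      by (intro winding_number_eq[where S = "ball 0 1"])
         (auto simp: pathfinish_compose pathstart_compose)
    moreover have "winding_number (f \<circ> circlepath 0 r) w = 0"
    proof (cases "norm w < s")
      case True
      then have "0 < s" using norm_ge_zero[of w] by linarith
      with True have "winding_number (f \<circ> circlepath 0 r) w = winding_number (f \<circ> circlepath 0 r) 0"
        using path[of r] r im_inner
        by (intro winding_number_eq[where S = "ball 0 s"])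
           (auto simp: pathfinish_compose pathstart_compose)
      then show ?thesis using wind_inner by simp
    next
      case False
      then show ?thesis
        using path[of r] r w im_inner
        by (intro winding_number_zero_outside[where s = "cball 0 s"])
           (auto simp: pathfinish_compose pathstart_compose)
    qed
    ultimately show "winding_number (f \<circ> circlepath 0 1) w =
        winding_number (f \<circ> circlepath 0 r) w + 1"
      using wind_outer by simp
  qed (use r w outer inner in auto)
  then have once': "\<exists>!z. z \<in> ?A \<and> f z = w" if "norm w < 1" "norm w \<noteq> s" for w
    using that by (simp add: annulus_def conj_assoc)
  have nconst: "\<not> f constant_on ?A"
  proof
    \<comment> \<open>Two values of different moduli strictly between \<open>s\<close> and 1, both of which are taken.\<close>
    define w where "w = complex_of_real ((s + 1) / 2)"
    define w' where "w' = complex_of_real ((s + 3) / 4)"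
    assume "f constant_on ?A"
    then obtain c where "\<And>z. z \<in> ?A \<Longrightarrow> f z = c" by (auto simp: constant_on_def)
    moreover have "\<exists>z\<in>?A. f z = w" "\<exists>z\<in>?A. f z = w'"
      using once'[of w] once'[of w'] s s0 by (auto simp: w_def w'_def norm_divide abs_if simp flip: of_real_add)
    ultimately have "w = w'" by auto
    then show False using s by (simp add: w_def w'_def)
  qed
  have open_image: "open (f ` U)" if "open U" "U \<subseteq> ?A" for U
    using open_mapping_thm[OF holA opA connA that nconst] .
  have le1: "norm (f z) \<le> 1" if "z \<in> ?A" for z
  proof (rule maximum_modulus_frontier[where S = ?A and f = f and \<xi> = z])
    show "f holomorphic_on interior ?A" using holA opA by (simp add: interior_open)
    have clos: "closure ?A \<subseteq> {z. r \<le> norm z \<and> norm z \<le> 1}"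
      by (rule closure_minimal)
         (auto simp: annulus_def intro!: closed_Collect_conj closed_Collect_le continuous_intros)
    also have "\<dots> \<subseteq> open_annulus a b" using r by (auto simp: open_annulus_def)
    finally show "continuous_on (closure ?A) f"
      by (intro holomorphic_on_imp_continuous_on holomorphic_on_subset[OF hol])
    show "bounded ?A" by (rule boundedI[of _ 1]) (auto simp: annulus_def)
    fix z assume "z \<in> frontier ?A"
    then have "z \<in> closure ?A" "z \<notin> ?A" using opA by (auto simp: frontier_def interior_open)
    then have "norm z = r \<or> norm z = 1" using clos by (force simp: annulus_def)
    then show "norm (f z) \<le> 1" using inner outer s by fastforce
  qed (use that in auto)
  have "f ` ?A \<subseteq> interior (cball 0 1)"
    using le1 open_image[OF opA] by (intro interior_maximal) auto
  then show lt1: "f ` ?A \<subseteq> ball 0 1" by simp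
  show "ball 0 s \<subseteq> f ` ?A"
  proof
    fix w assume "w \<in> ball (0::complex) s"
    then have "\<exists>!z. z \<in> ?A \<and> f z = w" using s by (intro once') auto
    then show "w \<in> f ` ?A" by auto
  qed
  show "inj_on f ?A"
  proof (rule inj_onI, rule ccontr)
    fix p q assume pq: "p \<in> ?A" "q \<in> ?A" "f p = f q" "p \<noteq> q"
    obtain U V where UV: "open U" "open V" "p \<in> U" "q \<in> V" "U \<inter> V = {}"
      using hausdorff[OF \<open>p \<noteq> q\<close>] by auto
    let ?W = "f ` (U \<inter> ?A) \<inter> f ` (V \<inter> ?A)"
    have opW: "open ?W" using UV opA by (intro open_Int open_image) auto
    have "f p \<in> f ` (U \<inter> ?A)" "f q \<in> f ` (V \<inter> ?A)" using pq UV by blast+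
    then have "f p \<in> ?W" using pq(3) by simp
    have "\<not> ?W \<subseteq> sphere 0 s"
    proof
      assume "?W \<subseteq> sphere 0 s"
      then have "negligible ?W" using negligible_subset[OF negligible_sphere] by blast
      then show False using open_not_negligible[OF opW] \<open>f p \<in> ?W\<close> by blast
    qed
    then obtain w where "w \<in> ?W" "w \<notin> sphere 0 s" by blast
    then have w: "w \<in> ?W" "norm w \<noteq> s" by simp_all
    then obtain p' q' where "p' \<in> U \<inter> ?A" "q' \<in> V \<inter> ?A" "w = f p'" "w = f q'" by blast
    moreover from this have "norm w < 1" using lt1 by auto
    ultimately show False using once'[of w] w UV by auto
  qed
qed

section \<open>The conformal map onto a slit disc\<close>

text \<open>
  The factor \<open>exp (g z)\<close> contributes nothing, since its logarithmic derivative has the single-valued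
  primitive \<open>g\<close>.
\<close>

lemma winding_number_linear_times_exp:
  assumes hol: "g holomorphic_on open_annulus a b"
    and \<rho>: "0 \<le> a" "a < \<rho>" "\<rho> < b" "norm p \<noteq> \<rho>"
  shows "winding_number ((\<lambda>z. (z - p) * exp (g z)) \<circ> circlepath 0 \<rho>) 0 =
    (if norm p < \<rho> then 1 else 0)"
proof -
  let ?f = "\<lambda>z. (z - p) * exp (g z)" and ?c = "circlepath (0::complex) \<rho>"
  have im: "path_image ?c \<subseteq> open_annulus a b" using \<rho> by (auto simp: open_annulus_def)
  have pc: "p \<notin> path_image ?c" using \<rho> by auto
  have dg: "(g has_field_derivative deriv g z) (at z)" if "z \<in> open_annulus a b" for z
    using that hol by (auto intro: holomorphic_derivI)
  have "winding_number (?f \<circ> ?c) 0 =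
      1 / (2 * pi * \<i>) * contour_integral ?c (\<lambda>z. deriv ?f z / (?f z - 0))"
    using im pc by (intro winding_number_image[where S = "open_annulus a b"] holomorphic_intros hol) auto
  also have "contour_integral ?c (\<lambda>z. deriv ?f z / (?f z - 0)) =
      contour_integral ?c (\<lambda>z. 1 / (z - p) + deriv g z)"
  proof (rule contour_integral_cong)
    fix z assume z: "z \<in> path_image ?c"
    have "(?f has_field_derivative exp (g z) + (z - p) * (exp (g z) * deriv g z)) (at z)"
      using dg[of z] z im by (auto intro!: derivative_eq_intros)
    then have df: "deriv ?f z = exp (g z) + (z - p) * (exp (g z) * deriv g z)"
      by (rule DERIV_imp_deriv)
    have "z \<noteq> p" using z pc by auto
    then show "deriv ?f z / (?f z - 0) = 1 / (z - p) + deriv g z"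
      unfolding df by (simp add: field_simps)
  qed auto
  also have "\<dots> = contour_integral ?c (\<lambda>z. 1 / (z - p)) + 0"
  proof -
    have "(deriv g has_contour_integral g (pathfinish ?c) - g (pathstart ?c)) ?c"
      using dg im by (intro contour_integral_primitive[where S = "open_annulus a b"])
        (auto intro: has_field_derivative_at_within)
    then have "(deriv g has_contour_integral 0) ?c" by simp
    moreover have "(\<lambda>z. 1 / (z - p)) contour_integrable_on ?c"
      using pc by (intro contour_integrable_holomorphic_simple[where S = "- {p}"] holomorphic_intros) auto
    ultimately show ?thesis
      by (intro contour_integral_unique has_contour_integral_add has_contour_integral_integral)
  qed
  also have "1 / (2 * pi * \<i>) * (contour_integral ?c (\<lambda>z. 1 / (z - p)) + 0) = winding_number ?c p"
    using pc by (simp add: winding_number_valid_path)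
  also have "\<dots> = (if norm p < \<rho> then 1 else 0)"
    using \<rho> by (auto intro!: winding_number_circlepath
        winding_number_zero_outside[where s = "cball 0 \<rho>"] simp: valid_path_imp_path)
  finally show ?thesis .
qed

text \<open>
  \<open>B\<close> is the power series with coefficients \<open>r\<^sup>2\<^sup>k (s\<^sup>-\<^sup>k - s\<^sup>k) / (k (1 - r\<^sup>2\<^sup>k))\<close>. The functional equation says
  \<open>(r\<^sup>-\<^sup>2\<^sup>k - 1) \<beta>\<^sub>k = (s\<^sup>-\<^sup>k - s\<^sup>k) / k\<close>, which determines them, the right-hand side being the coefficients
  of the difference of the two logarithms. It encodes the condition that the slit map have constant
  modulus on the inner circle; realness of the coefficients gives constant modulus on the outer one.
\<close>

lemma slit_map_exponent_exists:
  fixes r s :: real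
  assumes r: "0 < r" "r < s" "s < 1"
  obtains B :: "complex \<Rightarrow> complex"
  where "B holomorphic_on ball 0 (s / r\<^sup>2)"
    and "\<And>x. norm x < s / r\<^sup>2 \<Longrightarrow> B (cnj x) = cnj (B x)"
    and "\<And>x. norm x < s \<Longrightarrow>
      B (x / of_real (r\<^sup>2)) - B x = Ln (1 - of_real s * x) - Ln (1 - x / of_real s)"
proof -
  define q where "q = r\<^sup>2"
  have q: "0 < q" "q < 1" using r by (auto simp: q_def power_less_one_iff abs_square_less_1)
  \<comment> \<open>At \<open>k = 0\<close> the division by zero gives the coefficient 0.\<close>
  define \<beta> where "\<beta> = (\<lambda>k. q ^ k * ((1 / s) ^ k - s ^ k) / (of_nat k * (1 - q ^ k)))"
  define B where "B = (\<lambda>x. \<Sum>k. complex_of_real (\<beta> k) * x ^ k)"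
  have bound: "\<bar>\<beta> k\<bar> \<le> (q / s) ^ k / (1 - q)" for k
  proof (cases "k = 0")
    case False
    have "s ^ k \<le> 1" using r by (simp add: power_le_one)
    moreover have "1 \<le> (1 / s) ^ k" using r by (intro one_le_power) simp
    moreover have "0 \<le> s ^ k" using r by simp
    ultimately have num: "0 \<le> (1 / s) ^ k - s ^ k" "(1 / s) ^ k - s ^ k \<le> (1 / s) ^ k"
      by linarith+
    have "q ^ k \<le> q ^ 1" using q False by (intro power_decreasing) auto
    then have "1 - q \<le> 1 - q ^ k" by simp
    also have "\<dots> \<le> of_nat k * (1 - q ^ k)"
      using False q mult_right_mono[of 1 "of_nat k" "1 - q ^ k"] by (simp add: power_le_one)
    finally have den: "1 - q \<le> of_nat k * (1 - q ^ k)" .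
    have "\<bar>\<beta> k\<bar> = q ^ k * ((1 / s) ^ k - s ^ k) / (of_nat k * (1 - q ^ k))"
      using num den q unfolding \<beta>_def by (intro abs_of_nonneg divide_nonneg_pos mult_nonneg_nonneg) auto
    also have "\<dots> \<le> q ^ k * (1 / s) ^ k / (1 - q)"
      using num den q by (intro frac_le mult_left_mono) auto
    also have "q ^ k * (1 / s) ^ k = (q / s) ^ k" by (simp add: power_divide)
    finally show ?thesis .
  qed (use q in \<open>simp add: \<beta>_def\<close>)
  have sums: "(\<lambda>k. complex_of_real (\<beta> k) * x ^ k) sums B x" if x: "norm x < s / q" for x
  proof -
    have "summable (\<lambda>k. (q / s * norm x) ^ k / (1 - q))"
      using x q r by (intro summable_divide summable_geometric) (auto simp: field_simps)
    then have "summable (\<lambda>k. complex_of_real (\<beta> k) * x ^ k)"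
    proof (rule summable_comparison_test'[where N = 0])
      fix k
      show "norm (complex_of_real (\<beta> k) * x ^ k) \<le> (q / s * norm x) ^ k / (1 - q)"
        using mult_right_mono[OF bound[of k], of "norm x ^ k"]
        by (simp add: norm_mult norm_power power_mult_distrib power_divide)
    qed
    then show ?thesis unfolding B_def by (rule summable_sums)
  qed
  have lnsums: "(\<lambda>k. - (u ^ k) / of_nat k) sums Ln (1 - u)" if "norm u < 1" for u :: complex
    using Ln_series'[of "- u"] that by simp
  show ?thesis
  proof (rule that[of B])
    show "B holomorphic_on ball 0 (s / r\<^sup>2)"
      using sums by (intro power_series_holomorphic[where a = "\<lambda>k. complex_of_real (\<beta> k)"])
        (auto simp: q_def)
    show "B (cnj x) = cnj (B x)" if "norm x < s / r\<^sup>2" for x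
    proof -
      have "(\<lambda>k. cnj (complex_of_real (\<beta> k) * x ^ k)) sums cnj (B x)"
        using sums[of x] that by (simp only: sums_cnj q_def)
      moreover have "(\<lambda>k. cnj (complex_of_real (\<beta> k) * x ^ k)) sums B (cnj x)"
        using sums[of "cnj x"] that by (simp add: q_def)
      ultimately show ?thesis by (rule sums_unique2[symmetric])
    qed
    fix x :: complex assume x: "norm x < s"
    have "s < s / q" using q r by (simp add: less_divide_eq)
    then have "norm x < s / q" using x by linarith
    moreover have "norm (x / of_real q) < s / q"
      using x q by (simp add: norm_divide divide_strict_right_mono)
    ultimately have "(\<lambda>k. complex_of_real (\<beta> k) * (x / of_real q) ^ k - complex_of_real (\<beta> k) * x ^ k)
        sums (B (x / of_real q) - B x)"
      by (intro sums_diff sums)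
    moreover have "(\<lambda>k. - ((of_real s * x) ^ k) / of_nat k - - ((x / of_real s) ^ k) / of_nat k)
        sums (Ln (1 - of_real s * x) - Ln (1 - x / of_real s))"
    proof (intro sums_diff lnsums)
      have "norm (of_real s * x) \<le> 1 * norm x"
        using r by (simp add: norm_mult mult_left_le_one_le)
      then show "norm (of_real s * x) < 1" using x r by simp
      show "norm (x / of_real s) < 1" using x r by (simp add: norm_divide)
    qed
    moreover have "complex_of_real (\<beta> k) * (x / of_real q) ^ k - complex_of_real (\<beta> k) * x ^ k =
        - ((of_real s * x) ^ k) / of_nat k - - ((x / of_real s) ^ k) / of_nat k" for k
    proof (cases "k = 0")
      case False
      have "q ^ k < 1" using q False by (simp add: power_less_one_iff)
      then have "\<beta> k * (1 / q ^ k - 1) = ((1 / s) ^ k - s ^ k) / of_nat k"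
        using q False by (simp add: \<beta>_def divide_simps)
      then have "complex_of_real (\<beta> k) * (1 / of_real q ^ k - 1) =
          ((1 / of_real s) ^ k - of_real s ^ k) / of_nat k"
        by (simp only: of_real_mult of_real_diff of_real_divide of_real_power of_real_1
            of_real_of_nat_eq flip: of_real_eq_iff[where 'a = complex])
      then have "complex_of_real (\<beta> k) * (1 / of_real q ^ k - 1) * x ^ k =
          ((1 / of_real s) ^ k - of_real s ^ k) / of_nat k * x ^ k"
        by simp
      then show ?thesis
        by (simp add: power_divide power_mult_distrib algebra_simps diff_divide_distrib)
    qed simp
    ultimately show "B (x / of_real (r\<^sup>2)) - B x = Ln (1 - of_real s * x) - Ln (1 - x / of_real s)"
      unfolding q_def by (simp add: sums_unique2)
  qed
qed

text \<open>
  The extremal map is \<open>f z = (z - s) / (1 - s z) exp (B (1 / z) - B z)\<close>, in which \<open>1 / (1 - s z)\<close> is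
  absorbed into the exponential, so that only the factor \<open>z - s\<close> contributes to winding numbers. On the
  unit circle \<open>1 / z = cnj z\<close>, so \<open>B (1 / z) - B z\<close> is purely imaginary, and the Moebius factor
  \<open>(z - s) / (1 - s z)\<close> has modulus 1. On the inner circle \<open>1 / z = cnj (z / r\<^sup>2)\<close>, so by the functional
  equation of \<open>B\<close> the modulus of \<open>exp (B (1 / z) - B z)\<close> is \<open>|1 - s z| / |1 - z / s|\<close> and what is left
  is \<open>|z - s| / |1 - z / s| = s\<close>.
\<close>

lemma squeezing_ratio_attained_real:
  assumes r: "0 < r" "r < s" "s < 1"
  shows "s \<in> squeezing_ratios (annulus r) (of_real s)"
proof -
  obtain B where holB: "B holomorphic_on ball 0 (s / r\<^sup>2)"
    and Bcnj: "\<And>x. norm x < s / r\<^sup>2 \<Longrightarrow> B (cnj x) = cnj (B x)"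
    and Bfun: "\<And>x. norm x < s \<Longrightarrow>
      B (x / of_real (r\<^sup>2)) - B x = Ln (1 - of_real s * x) - Ln (1 - x / of_real s)"
    using slit_map_exponent_exists[OF r] by blast
  \<comment> \<open>The annulus on which \<open>B (1 / z)\<close>, \<open>B z\<close> and \<open>Ln (1 - s z)\<close> are all defined; it contains both
    boundary circles.\<close>
  define a b where "a = r\<^sup>2 / s" and "b = min (1 / s) (s / r\<^sup>2)"
  have s0 [simp]: "0 < s" "\<bar>s\<bar> = s" using r by auto
  have r2: "r\<^sup>2 < r" "0 < r\<^sup>2" using r by (simp_all add: power2_eq_square)
  have ab: "0 < a" "a < r" "1 < b"
    using r r2 by (auto simp: a_def b_def field_simps power2_eq_square)
  have mem: "norm z < s / r\<^sup>2" "norm (1 / z) < s / r\<^sup>2" "norm (of_real s * z) < 1" "z \<noteq> 0"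
    if "z \<in> open_annulus a b" for z
  proof -
    have z: "a < norm z" "norm z < 1 / s" "norm z < s / r\<^sup>2"
      using that by (auto simp: open_annulus_def b_def)
    then show "norm z < s / r\<^sup>2" by simp
    have "0 < norm z" using z(1) ab(1) by linarith
    then show "z \<noteq> 0" "norm (1 / z) < s / r\<^sup>2" "norm (of_real s * z) < 1"
      using z r r2 by (auto simp: a_def norm_mult norm_divide field_simps)
  qed
  define g where "g = (\<lambda>z. B (1 / z) - B z - Ln (1 - of_real s * z))"
  define f where "f = (\<lambda>z. (z - of_real s) * exp (g z))"
  have half: "1 - of_real s * z \<notin> \<real>\<^sub>\<le>\<^sub>0" if "z \<in> open_annulus a b" for z
    using mem(3)[OF that] complex_Re_le_cmod[of "of_real s * z"]
    by (auto simp: complex_nonpos_Reals_iff)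
  have holg: "g holomorphic_on open_annulus a b"
    unfolding g_def
  proof (intro holomorphic_on_diff)
    show "(\<lambda>z. B (1 / z)) holomorphic_on open_annulus a b"
    proof -
      have "(\<lambda>z. 1 / z) holomorphic_on open_annulus a b"
        using mem(4) by (intro holomorphic_intros) auto
      moreover have "(\<lambda>z. 1 / z) ` open_annulus a b \<subseteq> ball 0 (s / r\<^sup>2)"
        using mem(2) by auto
      ultimately show ?thesis
        using holomorphic_on_compose_gen[OF _ holB] by (auto simp: o_def)
    qed
    show "B holomorphic_on open_annulus a b"
      using holB by (rule holomorphic_on_subset) (use mem(1) in auto)
    show "(\<lambda>z. Ln (1 - of_real s * z)) holomorphic_on open_annulus a b"
      using half by (intro holomorphic_intros) auto
  qed
  have normf: "norm (f z) = norm (z - of_real s) * exp (Re (B (1 / z) - B z)) / norm (1 - of_real s * z)"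
    if "z \<in> open_annulus a b" for z
  proof -
    have "1 - of_real s * z \<noteq> 0" using half[OF that] by auto
    then have "exp (g z) = exp (B (1 / z) - B z) / (1 - of_real s * z)"
      unfolding g_def exp_diff[of "B (1 / z) - B z"] by simp
    then show ?thesis by (simp add: f_def norm_mult norm_divide)
  qed
  have outer: "norm (f z) = 1" if z: "norm z = 1" for z
  proof -
    have zA: "z \<in> open_annulus a b" using z ab r by (simp add: open_annulus_def)
    have zc: "z * cnj z = 1" using complex_norm_square[of z] z by simp
    have "z \<noteq> 0" using z by auto
    then have "1 / z = cnj z" using zc by (simp add: divide_eq_eq mult.commute)
    then have "Re (B (1 / z) - B z) = 0" using Bcnj[OF mem(1)[OF zA]] by simp
    moreover have "1 - of_real s * z = z * cnj (z - of_real s)"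
      using zc by (simp add: algebra_simps)
    then have "norm (1 - of_real s * z) = norm (z - of_real s)"
      using z by (simp only: norm_mult complex_mod_cnj)
    moreover have "z \<noteq> of_real s" using z r by auto
    ultimately show ?thesis using normf[OF zA] by simp
  qed
  have inner: "norm (f z) = s" if z: "norm z = r" for z
  proof -
    have zA: "z \<in> open_annulus a b" using z ab r by (simp add: open_annulus_def)
    have z0: "z \<noteq> 0" using z r by auto
    have zs: "norm z < s" "norm (z / of_real s) < 1" using z r by (auto simp: norm_divide)
    have "1 / z = cnj (z / of_real (r\<^sup>2))"
      using complex_norm_square[of z] z z0 r by (simp add: field_simps)
    moreover have "norm (z / of_real (r\<^sup>2)) < s / r\<^sup>2"
      using z r by (simp add: norm_divide norm_power divide_strict_right_mono)
    ultimately have "B (1 / z) = cnj (B (z / of_real (r\<^sup>2)))"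
      by (simp only: Bcnj)
    then have "Re (B (1 / z) - B z) = Re (B (z / of_real (r\<^sup>2)) - B z)" by simp
    also have "\<dots> = Re (Ln (1 - of_real s * z) - Ln (1 - z / of_real s))"
      using Bfun[OF zs(1)] by simp
    also have "exp \<dots> = norm (1 - of_real s * z) / norm (1 - z / of_real s)"
    proof -
      have "exp (Re (Ln u)) = norm u" if "u \<noteq> 0" for u
        using that by (simp flip: norm_exp_eq_Re)
      moreover have "1 - of_real s * z \<noteq> 0" "1 - z / of_real s \<noteq> 0"
        using half[OF zA] zs(2) by auto
      ultimately show ?thesis by (simp add: exp_diff)
    qed
    finally have "norm (f z) = norm (z - of_real s) / norm (1 - z / of_real s)"
      using normf[OF zA] half[OF zA] by auto
    moreover have "z - of_real s = - of_real s * (1 - z / of_real s)"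
      using r by (simp add: field_simps)
    then have "norm (z - of_real s) = s * norm (1 - z / of_real s)"
      using r by (simp only: norm_mult) simp
    moreover have "norm (1 - z / of_real s) \<noteq> 0" using zs(2) by auto
    ultimately show ?thesis by simp
  qed
  have holf: "f holomorphic_on open_annulus a b"
    unfolding f_def by (intro holomorphic_intros holg)
  have wind: "winding_number (f \<circ> circlepath 0 \<rho>) 0 = (if s < \<rho> then 1 else 0)"
    if "a < \<rho>" "\<rho> < b" "\<rho> \<noteq> s" for \<rho>
    using winding_number_linear_times_exp[OF holg, of \<rho> "of_real s"] that ab r by (simp add: f_def)
  note emb = embedding_by_boundary_values[OF holf, of r s]
  have "inj_on f (annulus r)" "ball 0 s \<subseteq> f ` annulus r" "f ` annulus r \<subseteq> ball 0 1"
    using emb outer inner wind[of 1] wind[of r] ab r by auto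
  moreover have "f holomorphic_on annulus r"
    using holf by (rule holomorphic_on_subset) (use ab in \<open>auto simp: annulus_def open_annulus_def\<close>)
  moreover have "f (of_real s) = 0" by (simp add: f_def)
  ultimately show ?thesis
    unfolding squeezing_ratios_def embeddings_at_def using r
    by (intro CollectI exI[of _ f] exI[of _ s] exI[of _ "1::real"]) auto
qed

section \<open>Automorphisms of the annulus and the squeezing function\<close>

lemma squeezing_ratios_automorphism:
  assumes "\<phi> holomorphic_on \<Omega>" "inj_on \<phi> \<Omega>" "\<phi> ` \<Omega> = \<Omega>"
  shows "squeezing_ratios \<Omega> (\<phi> p) \<subseteq> squeezing_ratios \<Omega> p"
proof
  fix x assume "x \<in> squeezing_ratios \<Omega> (\<phi> p)"
  then obtain f a b where x: "x = a / b" "0 < a" "0 < b" "ball 0 a \<subseteq> f ` \<Omega>" "f ` \<Omega> \<subseteq> ball 0 b"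
    and f: "f holomorphic_on \<Omega>" "inj_on f \<Omega>" "f (\<phi> p) = 0"
    by (auto simp: squeezing_ratios_def embeddings_at_def)
  have "f \<circ> \<phi> \<in> embeddings_at \<Omega> p"
    using f assms by (auto simp: embeddings_at_def intro: holomorphic_on_compose comp_inj_on)
  moreover have "(f \<circ> \<phi>) ` \<Omega> = f ` \<Omega>" using assms(3) by (metis image_comp)
  ultimately show "x \<in> squeezing_ratios \<Omega> p"
    using x unfolding squeezing_ratios_def by (intro CollectI exI[of _ "f \<circ> \<phi>"] exI[of _ a] exI[of _ b]) auto
qed

lemma squeezing_ratios_annulus_rotation:
  assumes "norm u = 1"
  shows "squeezing_ratios (annulus r) (u * p) \<subseteq> squeezing_ratios (annulus r) p"
proof (rule squeezing_ratios_automorphism)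
  have "u \<noteq> 0" using assms by auto
  then show "inj_on ((*) u) (annulus r)" by (auto intro: inj_onI)
  show "(*) u ` annulus r = annulus r"
  proof
    show "annulus r \<subseteq> (*) u ` annulus r"
    proof
      fix z assume "z \<in> annulus r"
      then show "z \<in> (*) u ` annulus r"
        using assms \<open>u \<noteq> 0\<close>
        by (intro image_eqI[of _ _ "z / u"]) (auto simp: annulus_def norm_divide)
    qed
  qed (use assms in \<open>auto simp: annulus_def norm_mult\<close>)
qed (intro holomorphic_intros)

lemma squeezing_ratios_annulus_inversion:
  assumes "0 < r"
  shows "squeezing_ratios (annulus r) (of_real r / p) \<subseteq> squeezing_ratios (annulus r) p"
proof (rule squeezing_ratios_automorphism)
  have nz: "z \<noteq> 0" if "z \<in> annulus r" for z using that assms by (auto simp: annulus_def)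
  show "(\<lambda>z. of_real r / z) holomorphic_on annulus r"
    using nz by (intro holomorphic_intros) auto
  show "inj_on (\<lambda>z. of_real r / z) (annulus r)"
    using nz assms by (auto intro!: inj_onI simp: field_simps)
  have maps: "of_real r / z \<in> annulus r" if "z \<in> annulus r" for z
  proof -
    have "0 < norm z" using nz[OF that] by simp
    then show ?thesis
      using that assms by (auto simp: annulus_def norm_divide field_simps)
  qed
  show "(\<lambda>z. of_real r / z) ` annulus r = annulus r"
  proof
    show "annulus r \<subseteq> (\<lambda>z. of_real r / z) ` annulus r"
    proof
      fix z assume z: "z \<in> annulus r"
      then show "z \<in> (\<lambda>z. of_real r / z) ` annulus r"
        using maps[OF z] nz[OF z] assms by (intro image_eqI[of _ _ "of_real r / z"]) auto
    qed
  qed (use maps in auto)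
qed

lemma squeezing_ratio_attained:
  assumes "0 < r" "r < norm p" "norm p < 1"
  shows "norm p \<in> squeezing_ratios (annulus r) p"
proof -
  define u where "u = of_real (norm p) / p"
  have "p \<noteq> 0" using assms by auto
  then have "norm u = 1" "u * p = of_real (norm p)" by (auto simp: u_def norm_divide)
  then show ?thesis
    using squeezing_ratios_annulus_rotation[of u r p] squeezing_ratio_attained_real[OF assms] by auto
qed

theorem theorem1p1:
  fixes r :: real and z :: complex
  assumes "0 < r" and "r < 1" and "r < norm z" and "norm z < 1"
  shows "squeezing (annulus r) z = max (norm z) (r / norm z)"
  unfolding squeezing_def
proof (rule cSup_eq_maximum)
  have z0: "0 < norm z" using assms by linarith
  have "norm z \<in> squeezing_ratios (annulus r) z"
    using assms by (intro squeezing_ratio_attained)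
  moreover have "r / norm z \<in> squeezing_ratios (annulus r) z"
  proof -
    have norm: "norm (of_real r / z) = r / norm z" using assms by (simp add: norm_divide)
    moreover have "r < r / norm z" "r / norm z < 1"
      using assms z0 by (auto simp: field_simps)
    ultimately show ?thesis
      using squeezing_ratio_attained[of r "of_real r / z"] squeezing_ratios_annulus_inversion[of r z] assms
      by auto
  qed
  ultimately show "max (norm z) (r / norm z) \<in> squeezing_ratios (annulus r) z"
    by (simp add: max_def)
  show "x \<le> max (norm z) (r / norm z)" if "x \<in> squeezing_ratios (annulus r) z" for x
    using that squeezing_ratio_upper_bound[OF assms(1,3,4)] unfolding squeezing_ratios_def by blast
qed

end
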